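(* Let $I=[0,1]$ with Lebesgue measure $\nu$ and $B(x,r)=\{z\in I:|x-z|<r\}$. The kernel $J_*$ satisfies: for every $x\ne y$ in $I$ and every $r>0$ with $0<r<|x-y|/2$, $$J_*(x,y)\ \le\ \frac2r\int_{B(x,r)}J_*(z,y)\,\nu(dz).$$
   Context: Let $\Sigma=\{0,1\}^{\mathbb N}$, $\pi:\Sigma\to I$, $\pi(i_1i_2\ldots)=\sum_{j\ge1}i_j2^{-j}$, and $n_*(\omega,\xi)=\min\{j:\omega_j\ne\xi_j\}-1$ for $\omega\neq\xi$ in $\Sigma$. For $x\ne y$ in $I$, $$J_*(x,y)=\frac{35}{16}\Big(\frac{14}{17}\Big(\frac{20}3\Big)^{n_*(\pi^{-1}(x),\pi^{-1}(y))}+\frac3{17}\Big),$$ where $n_*(\pi^{-1}(x),\pi^{-1}(y))=\max\{n_*(\omega,\xi):\omega\in\pi^{-1}(x),\ \xi\in\pi^{-1}(y)\}$. *)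

theory Defs
  imports "HOL-Analysis.Analysis"
begin

text \<open>
  Sequences are indexed by the positive integers; the argument \<open>0\<close> lies outside the
  extensional function space.
\<close>
definition Sigma01 :: "(nat \<Rightarrow> nat) set" where
  "Sigma01 = {1..} \<rightarrow>\<^sub>E {0, 1}"

definition coding :: "(nat \<Rightarrow> nat) \<Rightarrow> real" where
  "coding \<omega> = (\<Sum>j. real (\<omega> (Suc j)) / 2 ^ Suc j)"

definition fibre :: "real \<Rightarrow> (nat \<Rightarrow> nat) set" where
  "fibre x = {\<omega> \<in> Sigma01. coding \<omega> = x}"

text \<open>Only meaningful for distinct sequences; the subtraction then does not truncate.\<close>
definition n_star :: "(nat \<Rightarrow> nat) \<Rightarrow> (nat \<Rightarrow> nat) \<Rightarrow> nat" where
  "n_star \<omega> \<xi> = (LEAST j. j \<ge> 1 \<and> \<omega> j \<noteq> \<xi> j) - 1"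

text \<open>
  Meaningful for nonempty, finite, disjoint sets: fibres over distinct points of \<open>[0,1]\<close>
  are disjoint and have one or two elements each.
\<close>
definition n_star_set :: "(nat \<Rightarrow> nat) set \<Rightarrow> (nat \<Rightarrow> nat) set \<Rightarrow> nat" where
  "n_star_set A B = Max {n_star \<omega> \<xi> | \<omega> \<xi>. \<omega> \<in> A \<and> \<xi> \<in> B}"

text \<open>Only meaningful for distinct points of \<open>[0,1]\<close>.\<close>
definition J_star :: "real \<Rightarrow> real \<Rightarrow> real" where
  "J_star x y =
     35 / 16 * (14 / 17 * (20 / 3) ^ n_star_set (fibre x) (fibre y) + 3 / 17)"

definition ballI :: "real \<Rightarrow> real \<Rightarrow> real set" where
  "ballI x r = {z \<in> {0..1}. \<bar>x - z\<bar> < r}"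

end

theory Submission
  imports Defs
begin

text \<open>
  Two points have codes agreeing on their first \<open>n\<close> digits exactly when they lie in a common
  closed dyadic interval of length \<open>2\<^sup>-\<^sup>n\<close>. So \<open>n_star_set (fibre x) (fibre y)\<close> is the depth of
  the smallest closed dyadic interval containing both \<open>x\<close> and \<open>y\<close>. Dyadic intervals are convex:
  one that contains \<open>x\<close> and \<open>y\<close> contains every \<open>z\<close> between them. Hence moving \<open>z\<close> from
  \<open>x\<close> towards \<open>y\<close> can only increase the depth, and \<open>J_star z y\<close> with it
  (\<open>n_star_set_mono\<close>, \<open>J_star_mono\<close>).

  Since \<open>r < \<bar>x - y\<bar>\<close>, the half of the ball around \<open>x\<close> that faces \<open>y\<close> is an interval of length
  \<open>r\<close> lying between \<open>x\<close> and \<open>y\<close>, so it stays inside \<open>[0,1]\<close>, and \<open>J_star z y \<ge> J_star x y\<close>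
  on it. As the kernel is nonnegative, its integral over the ball is at least \<open>r * J_star x y\<close>.

  This comparison needs \<open>J_star z y\<close> to be integrable on the ball, because the Bochner integral of a
  non-integrable function is \<open>0\<close>. Monotonicity settles this too: the ball lies on one side of \<open>y\<close>,
  so the kernel is monotone there, hence measurable, and it is bounded by its value at the midpoint
  of \<open>x\<close> and \<open>y\<close>, which separates the ball from \<open>y\<close> (\<open>integrable_J_star_ball\<close>).
\<close>

section \<open>Binary expansions with a prescribed prefix\<close>

text \<open>The left endpoint of the level-\<open>n\<close> dyadic interval that the first \<open>n\<close> digits select.\<close>
definition dyadic_prefix :: "nat \<Rightarrow> (nat \<Rightarrow> nat) \<Rightarrow> real" where
  "dyadic_prefix n \<omega> = (\<Sum>j<n. real (\<omega> (Suc j)) / 2 ^ Suc j)"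

lemma Sigma01_iff:
  "\<omega> \<in> Sigma01 \<longleftrightarrow> \<omega> 0 = undefined \<and> (\<forall>j. \<omega> (Suc j) \<in> {0, 1})"
proof -
  have "\<omega> 0 = undefined" if "\<omega> \<in> Sigma01"
    using that PiE_arb[of \<omega> "{1..}" "\<lambda>_. {0, 1}" 0] unfolding Sigma01_def by simp
  moreover have "\<omega> (Suc j) \<in> {0, 1}" if "\<omega> \<in> Sigma01" for j
    using that PiE_mem[of \<omega> "{1..}" "\<lambda>_. {0, 1}" "Suc j"] unfolding Sigma01_def by simp
  moreover have "\<omega> \<in> Sigma01" if "\<omega> 0 = undefined" "\<forall>j. \<omega> (Suc j) \<in> {0, 1}"
    unfolding Sigma01_def
  proof (rule PiE_I)
    fix j :: nat
    show "\<omega> j \<in> {0, 1}" if "j \<in> {1..}"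
      using that \<open>\<forall>j. \<omega> (Suc j) \<in> {0, 1}\<close> by (cases j) auto
    show "\<omega> j = undefined" if "j \<notin> {1..}"
      using that \<open>\<omega> 0 = undefined\<close> by (cases j) auto
  qed
  ultimately show ?thesis by blast
qed

lemma dyadic_digit_bounds:
  assumes "\<omega> \<in> Sigma01"
  shows "0 \<le> real (\<omega> (Suc j)) / 2 ^ Suc j" "real (\<omega> (Suc j)) / 2 ^ Suc j \<le> (1 / 2) ^ Suc j"
proof -
  have "\<omega> (Suc j) \<in> {0, 1}"
    using assms by (auto simp: Sigma01_iff)
  then show "0 \<le> real (\<omega> (Suc j)) / 2 ^ Suc j" "real (\<omega> (Suc j)) / 2 ^ Suc j \<le> (1 / 2) ^ Suc j"
    by (auto simp: power_one_over)
qed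

lemma half_powers_sums: "(\<lambda>j. (1 / 2 :: real) ^ Suc j) sums 1"
  using power_half_series .

lemma coding_summable:
  assumes "\<omega> \<in> Sigma01"
  shows "summable (\<lambda>j. real (\<omega> (Suc j)) / 2 ^ Suc j)"
  by (rule summable_comparison_test'[OF sums_summable[OF half_powers_sums], of 0])
     (use dyadic_digit_bounds[OF assms] in auto)

lemma coding_dyadic_interval:
  assumes "\<omega> \<in> Sigma01"
  shows "coding \<omega> \<in> {dyadic_prefix n \<omega> .. dyadic_prefix n \<omega> + (1 / 2) ^ n}"
proof -
  let ?f = "\<lambda>j. real (\<omega> (Suc j)) / 2 ^ Suc j"
  let ?t = "\<Sum>j. ?f (j + n)"
  have split: "coding \<omega> = ?t + dyadic_prefix n \<omega>"
    unfolding coding_def dyadic_prefix_def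
    by (rule suminf_split_initial_segment[OF coding_summable[OF assms]])
  have summ: "summable (\<lambda>j. ?f (j + n))"
    using coding_summable[OF assms] by (rule summable_ignore_initial_segment)
  have geo: "(\<lambda>j. (1 / 2 :: real) ^ Suc (j + n)) sums ((1 / 2) ^ n)"
    using sums_mult[OF half_powers_sums, of "(1 / 2) ^ n"] by (simp add: power_add mult_ac)
  have "0 \<le> ?t"
    using summ dyadic_digit_bounds(1)[OF assms] by (intro suminf_nonneg)
  moreover have "?t \<le> (1 / 2) ^ n"
    using suminf_le[OF dyadic_digit_bounds(2)[OF assms] summ sums_summable[OF geo]]
    by (simp only: sums_unique[OF geo, symmetric])
  ultimately show ?thesis
    using split by simp
qed

text \<open>
  The converse of \<open>coding_dyadic_interval\<close>. Both endpoints of the closed interval are covered, the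
  right one by a tail of ones. The digits after the prefix come from iterating the doubling map on
  the rescaled position of \<open>z\<close> inside the interval.
\<close>
lemma expansion_with_prefix:
  assumes \<xi>: "\<xi> \<in> Sigma01"
    and z: "z \<in> {dyadic_prefix n \<xi> .. dyadic_prefix n \<xi> + (1 / 2) ^ n}"
  obtains \<zeta> where "\<zeta> \<in> fibre z" "\<And>j. j < n \<Longrightarrow> \<zeta> (Suc j) = \<xi> (Suc j)"
proof -
  define t where "t = rec_nat (2 ^ n * (z - dyadic_prefix n \<xi>))
    (\<lambda>_ s. 2 * s - of_bool (s \<ge> 1 / 2) :: real)"
  define \<zeta> where "\<zeta> = (\<lambda>j. case j of 0 \<Rightarrow> undefined
    | Suc i \<Rightarrow> if i < n then \<xi> (Suc i) else of_bool (t (i - n) \<ge> 1 / 2))"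
  have mem: "\<zeta> \<in> Sigma01"
    using \<xi> by (auto simp: Sigma01_iff \<zeta>_def)
  have agree: "\<zeta> (Suc j) = \<xi> (Suc j)" if "j < n" for j
    using that by (simp add: \<zeta>_def)
  have t0: "t 0 = 2 ^ n * (z - dyadic_prefix n \<xi>)"
    by (simp add: t_def)
  have t_Suc: "t (Suc k) = 2 * t k - of_bool (t k \<ge> 1 / 2)" for k
    by (simp add: t_def)
  have t_range: "t k \<in> {0..1}" for k
  proof (induction k)
    case 0
    show ?case using z by (simp add: t0 power_one_over field_simps)
  next
    case (Suc k)
    then show ?case by (auto simp: t_Suc)
  qed
  have same: "dyadic_prefix n \<zeta> = dyadic_prefix n \<xi>"
    unfolding dyadic_prefix_def by (intro sum.cong) (auto simp: agree)
  \<comment> \<open>Invariant of the doubling iteration: \<open>t k\<close> is the position of \<open>z\<close> within the current dyadic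
    interval, rescaled to \<open>[0,1]\<close>.\<close>
  have remainder: "z = dyadic_prefix (k + n) \<zeta> + t k / 2 ^ (k + n)" for k
  proof (induction k)
    case 0
    show ?case by (simp add: t0 same)
  next
    case (Suc k)
    have "dyadic_prefix (Suc k + n) \<zeta>
        = dyadic_prefix (k + n) \<zeta> + of_bool (t k \<ge> 1 / 2) / 2 ^ Suc (k + n)"
      by (simp add: dyadic_prefix_def \<zeta>_def)
    then show ?case
      using Suc by (simp add: t_Suc diff_divide_distrib)
  qed
  have gap: "\<bar>z - coding \<zeta>\<bar> \<le> (1 / 2) ^ k" for k
  proof -
    have "t k / 2 ^ (k + n) \<in> {0 .. (1 / 2) ^ (k + n)}"
      using t_range[of k] by (simp add: power_one_over divide_right_mono)
    then have "\<bar>z - coding \<zeta>\<bar> \<le> (1 / 2) ^ (k + n)"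
      using remainder[of k] coding_dyadic_interval[OF mem, of "k + n"] by auto
    also have "\<dots> \<le> (1 / 2) ^ k"
      by (rule power_decreasing) auto
    finally show ?thesis .
  qed
  have "\<bar>z - coding \<zeta>\<bar> \<le> 0"
    by (rule LIMSEQ_le_const[OF LIMSEQ_realpow_zero[of "1 / 2"]]) (use gap in auto)
  then have "\<zeta> \<in> fibre z"
    using mem by (simp add: fibre_def)
  then show thesis
    using agree that by blast
qed

lemma fibre_nonempty:
  assumes "z \<in> {0..1}"
  shows "fibre z \<noteq> {}"
proof -
  have "(\<lambda>j. if j = 0 then undefined else 0) \<in> Sigma01"
    by (simp add: Sigma01_iff)
  from expansion_with_prefix[OF this, of z 0] assms show ?thesis
    by (auto simp: dyadic_prefix_def)
qed

section \<open>Monotonicity of the kernel\<close>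

text \<open>
  The index shift makes \<open>n_star\<close> the length of the longest common prefix, with digits numbered from
  \<open>1\<close>. Distinctness of the sequences is what makes the least index meaningful.
\<close>
lemma le_n_star_iff:
  assumes "\<omega> \<in> Sigma01" "\<xi> \<in> Sigma01" "\<omega> \<noteq> \<xi>"
  shows "n \<le> n_star \<omega> \<xi> \<longleftrightarrow> (\<forall>j<n. \<omega> (Suc j) = \<xi> (Suc j))"
proof -
  let ?P = "\<lambda>j. j \<ge> 1 \<and> \<omega> j \<noteq> \<xi> j"
  define m where "m = (LEAST j. ?P j)"
  obtain i where "\<omega> i \<noteq> \<xi> i"
    using assms(3) by blast
  then have "?P i"
    using assms(1,2) by (cases i) (auto simp: Sigma01_iff)
  then have Pm: "?P m"
    unfolding m_def by (rule LeastI)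
  have below: "\<not> ?P j" if "j < m" for j
    using that unfolding m_def by (rule not_less_Least)
  have nm: "n_star \<omega> \<xi> = m - 1"
    by (simp add: n_star_def m_def)
  show ?thesis
  proof
    assume "n \<le> n_star \<omega> \<xi>"
    show "\<forall>j<n. \<omega> (Suc j) = \<xi> (Suc j)"
    proof (intro allI impI)
      fix j assume "j < n"
      then have "Suc j < m"
        using \<open>n \<le> n_star \<omega> \<xi>\<close> nm by linarith
      then show "\<omega> (Suc j) = \<xi> (Suc j)"
        using below[of "Suc j"] by simp
    qed
  next
    assume agree: "\<forall>j<n. \<omega> (Suc j) = \<xi> (Suc j)"
    show "n \<le> n_star \<omega> \<xi>"
    proof (rule ccontr)
      assume "\<not> n \<le> n_star \<omega> \<xi>"
      then have "m - 1 < n" using nm by simp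
      with agree Pm show False by (metis Suc_diff_1 less_le_trans zero_less_one)
    qed
  qed
qed

lemma common_dyadic_interval:
  assumes "x \<noteq> y" "\<omega> \<in> fibre x" "\<xi> \<in> fibre y" "n \<le> n_star \<omega> \<xi>"
  shows "x \<in> {dyadic_prefix n \<xi> .. dyadic_prefix n \<xi> + (1 / 2) ^ n}"
    and "y \<in> {dyadic_prefix n \<xi> .. dyadic_prefix n \<xi> + (1 / 2) ^ n}"
proof -
  have mem: "\<omega> \<in> Sigma01" "\<xi> \<in> Sigma01" "coding \<omega> = x" "coding \<xi> = y"
    using assms by (auto simp: fibre_def)
  then have "\<omega> \<noteq> \<xi>"
    using assms(1) by auto
  then have "dyadic_prefix n \<omega> = dyadic_prefix n \<xi>"
    unfolding dyadic_prefix_def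
    using assms(4) le_n_star_iff[OF mem(1,2)] by (intro sum.cong) auto
  then show "x \<in> {dyadic_prefix n \<xi> .. dyadic_prefix n \<xi> + (1 / 2) ^ n}"
    and "y \<in> {dyadic_prefix n \<xi> .. dyadic_prefix n \<xi> + (1 / 2) ^ n}"
    using coding_dyadic_interval[OF mem(1), of n] coding_dyadic_interval[OF mem(2), of n] mem
    by auto
qed

text \<open>
  A common prefix of length \<open>n\<close> forces \<open>\<bar>x - y\<bar> \<le> 2\<^sup>-\<^sup>n\<close>, which bounds the values. With this, the
  maximum in \<open>n_star_set\<close> is a genuine one without any analysis of how many codes a point has.
\<close>
lemma finite_n_star_values:
  assumes "x \<noteq> y"
  shows "finite {n_star \<omega> \<xi> | \<omega> \<xi>. \<omega> \<in> fibre x \<and> \<xi> \<in> fibre y}"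
proof -
  obtain k where k: "(1 / 2 :: real) ^ k < \<bar>x - y\<bar>"
    using real_arch_pow_inv[of "\<bar>x - y\<bar>" "1 / 2"] assms by auto
  have "n_star \<omega> \<xi> \<le> k" if "\<omega> \<in> fibre x" "\<xi> \<in> fibre y" for \<omega> \<xi>
    using common_dyadic_interval[OF assms that, of k] k by (cases "k \<le> n_star \<omega> \<xi>") auto
  then show ?thesis
    by (intro finite_subset[OF _ finite_atMost[of k]]) auto
qed

text \<open>
  Take codes \<open>\<omega>\<close> of \<open>x\<close> and \<open>\<xi>\<close> of \<open>y\<close> attaining the maximum. The dyadic interval of their
  common prefix contains \<open>x\<close> and \<open>y\<close>, hence \<open>z\<close>, so \<open>z\<close> has a code with this same prefix. That
  both codes of a dyadic rational are admitted matters here: \<open>z\<close> may be an endpoint of the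
  interval, where only one of its two codes continues the prefix.
\<close>
lemma n_star_set_mono:
  assumes "x \<in> {0..1}" "y \<in> {0..1}" "z \<noteq> y" "z \<in> closed_segment x y"
  shows "n_star_set (fibre x) (fibre y) \<le> n_star_set (fibre z) (fibre y)"
proof -
  let ?S = "\<lambda>x. {n_star \<omega> \<xi> | \<omega> \<xi>. \<omega> \<in> fibre x \<and> \<xi> \<in> fibre y}"
  have "x \<noteq> y"
    using assms(3,4) by auto
  have "?S x \<noteq> {}"
    using fibre_nonempty[OF assms(1)] fibre_nonempty[OF assms(2)] by auto
  then have "Max (?S x) \<in> ?S x"
    by (rule Max_in[OF finite_n_star_values[OF \<open>x \<noteq> y\<close>]])
  then obtain \<omega> \<xi> where *: "\<omega> \<in> fibre x" "\<xi> \<in> fibre y"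
      and n: "n_star_set (fibre x) (fibre y) = n_star \<omega> \<xi>"
    by (auto simp: n_star_set_def)
  let ?n = "n_star \<omega> \<xi>"
  have \<xi>: "\<xi> \<in> Sigma01"
    using * by (simp add: fibre_def)
  have "z \<in> {dyadic_prefix ?n \<xi> .. dyadic_prefix ?n \<xi> + (1 / 2) ^ ?n}"
    using common_dyadic_interval[OF \<open>x \<noteq> y\<close> *, of ?n] assms(4)
    by (auto simp: closed_segment_eq_real_ivl split: if_splits)
  from expansion_with_prefix[OF \<xi> this] obtain \<zeta>
    where \<zeta>: "\<zeta> \<in> fibre z" "\<And>j. j < ?n \<Longrightarrow> \<zeta> (Suc j) = \<xi> (Suc j)"
    by blast
  have "\<zeta> \<in> Sigma01" "\<zeta> \<noteq> \<xi>"
    using \<zeta>(1) *(2) assms(3) by (auto simp: fibre_def)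
  then have "?n \<le> n_star \<zeta> \<xi>"
    using le_n_star_iff[of \<zeta> \<xi> ?n] \<xi> \<zeta>(2) by blast
  also have "\<dots> \<le> Max (?S z)"
    using \<zeta>(1) *(2) by (intro Max_ge[OF finite_n_star_values[OF assms(3)]]) auto
  finally show ?thesis
    using n by (simp add: n_star_set_def)
qed

lemma J_star_nonneg: "0 \<le> J_star x y"
  by (simp add: J_star_def)

lemma J_star_mono:
  assumes "x \<in> {0..1}" "y \<in> {0..1}" "z \<noteq> y" "z \<in> closed_segment x y"
  shows "J_star x y \<le> J_star z y"
  using power_increasing[OF n_star_set_mono[OF assms], of "20 / 3 :: real"]
  by (simp add: J_star_def)

section \<open>Integrability of the kernel on balls away from its pole\<close>

lemma ballI_eq: "ballI x r = {0..1} \<inter> {x - r<..<x + r}"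
  by (auto simp: ballI_def)

text \<open>
  The ball misses \<open>y\<close>, so by \<open>J_star_mono\<close> the kernel is increasing on it if it lies to the left of
  \<open>y\<close> and decreasing if it lies to the right.
\<close>
lemma borel_measurable_J_star_ball:
  assumes "x \<in> {0..1}" "y \<in> {0..1}" "r < \<bar>x - y\<bar>"
  shows "(\<lambda>z. indicator (ballI x r) z *\<^sub>R J_star z y) \<in> borel_measurable borel"
proof -
  let ?B = "ballI x r"
  have "(\<lambda>z. J_star z y) \<in> borel_measurable (restrict_space borel ?B)"
  proof (cases "x < y")
    case True
    have "mono_on ?B (\<lambda>z. J_star z y)"
      using True assms by (intro mono_onI J_star_mono)
        (auto simp: ballI_def closed_segment_eq_real_ivl)
    then show ?thesis
      by (rule borel_measurable_mono_on_fnc)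
  next
    case False
    have "mono_on ?B (\<lambda>z. - J_star z y)"
      using False assms by (intro mono_onI le_imp_neg_le J_star_mono)
        (auto simp: ballI_def closed_segment_eq_real_ivl)
    then have "(\<lambda>z. - J_star z y) \<in> borel_measurable (restrict_space borel ?B)"
      by (rule borel_measurable_mono_on_fnc)
    from borel_measurable_uminus[OF this] show ?thesis
      by simp
  qed
  moreover have "?B \<inter> space borel \<in> sets borel"
    by (simp add: ballI_eq)
  ultimately show ?thesis
    by (simp add: borel_measurable_restrict_space_iff)
qed

lemma integrable_J_star_ball:
  assumes "x \<in> {0..1}" "y \<in> {0..1}" "0 < r" "r < \<bar>x - y\<bar> / 2"
  shows "set_integrable (lebesgue_on {0..1}) (ballI x r) (\<lambda>z. J_star z y)"
proof -
  interpret finite_measure "lebesgue_on {0..1 :: real}"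
    by (rule finite_measure_lebesgue_on) simp
  let ?g = "\<lambda>z. indicator (ballI x r) z *\<^sub>R J_star z y"
  have "?g \<in> borel_measurable borel"
    using assms by (intro borel_measurable_J_star_ball) auto
  then have "?g \<in> borel_measurable (lebesgue_on {0..1})"
    by (intro measurable_restrict_space1 measurable_completion) simp
  moreover have "norm (?g z) \<le> J_star ((x + y) / 2) y" for z
  proof (cases "z \<in> ballI x r")
    case True
    have "J_star z y \<le> J_star ((x + y) / 2) y"
      using True assms by (intro J_star_mono)
        (auto simp: ballI_def closed_segment_eq_real_ivl abs_if field_simps split: if_splits)
    then show ?thesis
      using True J_star_nonneg[of z y] by simp
  qed (simp add: J_star_nonneg)
  ultimately show ?thesis
    unfolding set_integrable_def by (intro integrable_const_bound) auto
qed

theorem proposition4p5: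
  fixes x y r :: real
  assumes "x \<in> {0..1}" and "y \<in> {0..1}" and "x \<noteq> y"
    and "0 < r" and "r < \<bar>x - y\<bar> / 2"
  shows "J_star x y \<le> 2 / r * (LINT z:ballI x r|lebesgue_on {0..1}. J_star z y)"
proof -
  let ?M = "lebesgue_on {0..1 :: real}"
  let ?B = "ballI x r"
  \<comment> \<open>The point at distance \<open>r\<close> from \<open>x\<close> in the direction of \<open>y\<close>; \<open>S\<close> is the half of the ball
    facing \<open>y\<close>.\<close>
  define w where "w = x + sgn (y - x) * r"
  define S where "S = {min x w<..<max x w}"
  have S_sub: "S \<subseteq> ?B"
    using assms by (auto simp: S_def w_def ballI_def sgn_if split: if_splits)
  have S01: "S \<subseteq> {0..1}"
    using S_sub by (auto simp: ballI_def)
  have J_S: "J_star x y \<le> J_star z y" if "z \<in> S" for z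
    using that assms by (intro J_star_mono)
      (auto simp: S_def w_def closed_segment_eq_real_ivl sgn_if split: if_splits)
  have "measure ?M S = measure lebesgue S"
    using S01 by (intro measure_restrict_space) auto
  also have "\<dots> = r"
    using assms by (simp add: S_def w_def sgn_if)
  finally have meas: "measure ?M S = r" .
  interpret finite_measure ?M
    by (rule finite_measure_lebesgue_on) simp
  have S_sets: "S \<in> sets ?M"
    using S01 by (simp add: sets_restrict_space_iff S_def)
  have "r * J_star x y = (LINT z|?M. indicator S z * J_star x y)"
    using S_sets sets.sets_into_space[OF S_sets] by (simp add: meas Int_absorb2)
  also have "\<dots> \<le> (LINT z:?B|?M. J_star z y)"
    unfolding set_lebesgue_integral_def
  proof (rule integral_mono)
    show "integrable ?M (\<lambda>z. indicator S z * J_star x y)"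
      using S_sets by (intro integrable_mult_left integrable_real_indicator)
        (auto simp: less_top[symmetric])
    show "integrable ?M (\<lambda>z. indicator ?B z *\<^sub>R J_star z y)"
      using integrable_J_star_ball[OF assms(1,2,4,5)] by (simp add: set_integrable_def)
    show "indicator S z * J_star x y \<le> indicator ?B z *\<^sub>R J_star z y" for z
      using J_S[of z] S_sub J_star_nonneg[of z y] by (auto simp: indicator_def)
  qed
  finally have main: "r * J_star x y \<le> (LINT z:?B|?M. J_star z y)" .
  then have "J_star x y \<le> (LINT z:?B|?M. J_star z y) / r"
    using assms(4) by (simp add: field_simps)
  moreover have "0 \<le> (LINT z:?B|?M. J_star z y) / r"
    using main J_star_nonneg[of x y] assms(4)
    by (meson divide_nonneg_pos mult_nonneg_nonneg less_imp_le order_trans)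
  ultimately show ?thesis
    by simp
qed

end
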